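(* Let $y$ be uniform on $\{1,\dots,K\}$. For each $k$ let $q(z_c,z_s\mid y=k)$ be a joint probability distribution of $(z_c,z_s)$, let $p(z_c\mid y=k)$ be a probability distribution for $z_c$, and let $p(z_s)$ be a probability distribution for $z_s$, namely $p(z_s)=\mathcal N(0,I)$. Define $$M_{\mathrm{fact}} := \mathbb E_y\bigl[\mathrm{KL}\bigl(q(z_c,z_s\mid y)\,\|\,p(z_c\mid y)\,p(z_s)\bigr)\bigr].$$ Then $$M_{\mathrm{fact}} = I_q(z_c;z_s\mid y) + \mathbb E_y\bigl[\mathrm{KL}(q(z_c\mid y)\,\|\,p(z_c\mid y))\bigr] + I_q(z_s;y) + \mathrm{KL}(q(z_s)\,\|\,p(z_s)),$$ and all four terms on the right-hand side are non-negative.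
   Context: Here $K\ge 1$ is an integer; $z_c$ (the semantic variable) takes values in a measurable space and $z_s$ (the style variable) takes values in $\mathbb R^{d_s}$. $q(z_c,z_s\mid y=k)$ is the encoder's joint class-conditional distribution; $q(z_c\mid y=k)$ and $q(z_s\mid y=k)$ are its marginals, and $q(z_s)=\mathbb E_y[q(z_s\mid y)]=\frac1K\sum_{k=1}^K q(z_s\mid y=k)$ is the aggregated style distribution. $p(z_c\mid y)\,p(z_s)$ denotes the product measure (the law of independently drawn $z_c\sim p(z_c\mid y)$ and $z_s\sim p(z_s)$). $\mathbb E_y$ is expectation over the uniform label $y$. $\mathrm{KL}$ is the Kullback–Leibler divergence, with values in $[0,\infty]$. $I_q(z_s;y)$ is the mutual information of $z_s$ and $y$ under the joint law in which $y$ is uniform and $z_s\mid y\sim q(z_s\mid y)$. $I_q(z_c;z_s\mid y)=\mathbb E_y[I_q(z_c;z_s\mid y=k)]$ is the conditional mutual information, where $I_q(z_c;z_s\mid y=k)=\mathrm{KL}(q(z_c,z_s\mid y=k)\,\|\,q(z_c\mid y=k)\,q(z_s\mid y=k))$. *)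

theory Defs
  imports "HOL-Probability.Probability"
begin

text \<open>
  The library's \<open>KL_divergence b Q P\<close> takes the reference measure first and is a real-valued
  Bochner integral, so the infinite cases have to be added. For probability measures with
  \<open>P\<close> absolutely continuous with respect to \<open>Q\<close>, the negative part of \<open>ln (dP/dQ)\<close> is
  always \<open>P\<close>-integrable, so non-integrability means that the divergence
  is \<open>\<infinity>\<close>. The values are taken in \<^typ>\<open>ereal\<close>, so that non-negativity is not
  built into the type. Logarithms are natural.
\<close>
definition KL :: "'a measure \<Rightarrow> 'a measure \<Rightarrow> ereal" where
  "KL P Q =
    (if absolutely_continuous Q P \<and> integrable P (entropy_density (exp 1) Q P)
     then ereal (KL_divergence (exp 1) Q P) else \<infinity>)"

text \<open>Mutual information of the two coordinates under a joint law \<open>J\<close> on \<open>S \<Otimes>\<^sub>M T\<close>.\<close>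
definition mutual_info :: "'a measure \<Rightarrow> 'b measure \<Rightarrow> ('a \<times> 'b) measure \<Rightarrow> ereal" where
  "mutual_info S T J = KL J (distr J S fst \<Otimes>\<^sub>M distr J T snd)"

definition label_dist :: "nat \<Rightarrow> nat measure" where
  "label_dist K = uniform_count_measure {1..K}"

text \<open>Written as a finite average because the Bochner integral is not available for
  \<^typ>\<open>ereal\<close>-valued functions.\<close>
definition label_expectation :: "nat \<Rightarrow> (nat \<Rightarrow> ereal) \<Rightarrow> ereal" where
  "label_expectation K f = (\<Sum>k\<in>{1..K}. f k) / ereal (real K)"

definition std_gaussian :: "(real ^ 'd) measure" where
  "std_gaussian = density lborel
    (\<lambda>x. ennreal (exp (- (norm x)\<^sup>2 / 2) / (2 * pi) powr (real CARD('d) / 2)))"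

text \<open>In the following, \<open>q k\<close> is the joint law of \<open>(z_c, z_s)\<close> given \<open>y = k\<close>,
  on \<open>Zc \<Otimes>\<^sub>M borel\<close>.\<close>

definition semantic_marginal ::
    "'c measure \<Rightarrow> (nat \<Rightarrow> ('c \<times> (real ^ 'd)) measure) \<Rightarrow> nat \<Rightarrow> 'c measure" where
  "semantic_marginal Zc q k = distr (q k) Zc fst"

definition style_marginal ::
    "(nat \<Rightarrow> ('c \<times> (real ^ 'd)) measure) \<Rightarrow> nat \<Rightarrow> (real ^ 'd) measure" where
  "style_marginal q k = distr (q k) borel snd"

text \<open>The mixture \<open>(1/K) \<Sum>\<^sub>k q(z_s | y = k)\<close>.\<close>
definition aggregated_style ::
    "nat \<Rightarrow> (nat \<Rightarrow> ('c \<times> (real ^ 'd)) measure) \<Rightarrow> (real ^ 'd) measure" where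
  "aggregated_style K q = label_dist K \<bind> style_marginal q"

text \<open>The law of \<open>(z_s, y)\<close> with \<open>y\<close> uniform and \<open>z_s | y\<close> distributed as
  \<open>q(z_s | y)\<close>.\<close>
definition style_label_law ::
    "nat \<Rightarrow> (nat \<Rightarrow> ('c \<times> (real ^ 'd)) measure) \<Rightarrow> ((real ^ 'd) \<times> nat) measure" where
  "style_label_law K q = label_dist K \<bind>
    (\<lambda>k. distr (style_marginal q k) (borel \<Otimes>\<^sub>M label_dist K) (\<lambda>s. (s, k)))"

definition style_label_mutual_info ::
    "nat \<Rightarrow> (nat \<Rightarrow> ('c \<times> (real ^ 'd)) measure) \<Rightarrow> ereal" where
  "style_label_mutual_info K q = mutual_info borel (label_dist K) (style_label_law K q)"

definition cond_mutual_info ::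
    "nat \<Rightarrow> 'c measure \<Rightarrow> (nat \<Rightarrow> ('c \<times> (real ^ 'd)) measure) \<Rightarrow> ereal" where
  "cond_mutual_info K Zc q = label_expectation K (\<lambda>k. mutual_info Zc borel (q k))"

definition M_fact ::
    "nat \<Rightarrow> (nat \<Rightarrow> ('c \<times> (real ^ 'd)) measure) \<Rightarrow> (nat \<Rightarrow> 'c measure) \<Rightarrow> (real ^ 'd) measure \<Rightarrow> ereal" where
  "M_fact K q pc ps = label_expectation K (\<lambda>k. KL (q k) (pc k \<Otimes>\<^sub>M ps))"

end

theory Submission
  imports Defs
begin

text \<open>The identity \<open>KL (P | A \<Otimes> B) = I(P) + KL (P\<^sub>1 | A) + KL (P\<^sub>2 | B)\<close>, valid in \<open>[0, \<infinity>]\<close> for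
  a joint law \<open>P\<close> with marginals \<open>P\<^sub>1, P\<^sub>2\<close>, is used twice. Applied to each \<open>q(z_c, z_s | y = k)\<close>
  and averaged, it leaves the term \<open>E\<^sub>y KL (q(z_s | y) | p(z_s))\<close>. This average is the divergence of
  the law of \<open>(z_s, y)\<close> from \<open>p(z_s) \<Otimes> uniform\<close>, to which the identity applies again; there the
  divergence of the second marginals vanishes.\<close>

section \<open>Integrals taking the value infinity\<close>

text \<open>Follows the convention of \<open>KL\<close>: for a measurable function with integrable
  negative part, failure of integrability means that the integral is infinity. The log-densities
  below are of this kind.\<close>

definition ext_integral :: "'a measure \<Rightarrow> ('a \<Rightarrow> real) \<Rightarrow> ereal" where
  "ext_integral M f = (if integrable M f then ereal (integral\<^sup>L M f) else \<infinity>)"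

lemma ext_integral_cong_AE:
  assumes "f \<in> borel_measurable M" "g \<in> borel_measurable M" "AE x in M. f x = g x"
  shows "ext_integral M f = ext_integral M g"
  using integrable_cong_AE[OF assms] integral_cong_AE[OF assms] by (simp add: ext_integral_def)

lemma ext_integral_distr:
  assumes "t \<in> measurable M N" "f \<in> borel_measurable N"
  shows "ext_integral (distr M N t) f = ext_integral M (\<lambda>x. f (t x))"
  using assms by (simp add: ext_integral_def integrable_distr_eq integral_distr)

text \<open>Where \<open>f\<close> is non-negative, \<open>f = (f + g) - g\<close> is at most
  \<open>\<bar>f + g\<bar>\<close> plus the negative part of \<open>g\<close>; elsewhere
  \<open>\<bar>f\<bar>\<close> is the negative part of \<open>f\<close>. The sum of all three bounds
  dominates \<open>\<bar>f\<bar>\<close>.\<close>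

lemma integrable_summand_of_negative_parts:
  fixes f g :: "'a \<Rightarrow> real"
  assumes fg: "integrable M (\<lambda>x. f x + g x)"
    and [measurable]: "f \<in> borel_measurable M"
    and "integrable M (\<lambda>x. max 0 (- f x))" "integrable M (\<lambda>x. max 0 (- g x))"
  shows "integrable M f"
proof (rule Bochner_Integration.integrable_bound)
  show "integrable M (\<lambda>x. \<bar>f x + g x\<bar> + (max 0 (- f x) + max 0 (- g x)))"
    by (intro Bochner_Integration.integrable_add[OF integrable_abs[OF fg]] Bochner_Integration.integrable_add assms)
  show "AE x in M. norm (f x) \<le> norm (\<bar>f x + g x\<bar> + (max 0 (- f x) + max 0 (- g x)))"
    by (auto simp: abs_if max_def)
qed simp

text \<open>Integrable negative parts rule out cancellation of infinities: the sum is integrable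
  exactly when both summands are, so the two sides become infinite together.\<close>

lemma ext_integral_add:
  fixes f g :: "'a \<Rightarrow> real"
  assumes [measurable]: "f \<in> borel_measurable M" "g \<in> borel_measurable M"
    and neg: "integrable M (\<lambda>x. max 0 (- f x))" "integrable M (\<lambda>x. max 0 (- g x))"
  shows "ext_integral M (\<lambda>x. f x + g x) = ext_integral M f + ext_integral M g"
proof (cases "integrable M (\<lambda>x. f x + g x)")
  case True
  have "integrable M f"
    using integrable_summand_of_negative_parts[OF True _ neg] by simp
  moreover have "integrable M g"
    using integrable_summand_of_negative_parts[of M g f] True neg by (simp add: add.commute)
  ultimately show ?thesis by (simp add: ext_integral_def)
next
  case False
  then have "\<not> integrable M f \<or> \<not> integrable M g" by auto
  with False show ?thesis by (auto simp: ext_integral_def)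
qed

section \<open>Divergence through real densities\<close>

text \<open>Uniqueness of the Radon-Nikodym derivative identifies \<open>g\<close> with
  \<open>RN_deriv Q P\<close>, first \<open>Q\<close>-almost everywhere and then
  \<open>P\<close>-almost everywhere. A divergence can thus be computed from any explicit
  non-negative density.\<close>

lemma KL_density_eq:
  assumes "sigma_finite_measure Q" and [measurable]: "g \<in> borel_measurable Q"
    and nonneg: "\<And>x. 0 \<le> g x" and P: "P = density Q (\<lambda>x. ennreal (g x))"
  shows "KL P Q = ext_integral P (\<lambda>x. ln (g x))"
proof -
  interpret Q: sigma_finite_measure Q by fact
  have [measurable_cong]: "sets P = sets Q" by (simp add: P)
  have ac: "absolutely_continuous Q P"
    unfolding P by (rule absolutely_continuousI_density) simp
  have "AE x in Q. ennreal (g x) = RN_deriv Q P x"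
    by (rule Q.RN_deriv_unique) (simp_all add: P)
  then have "AE x in P. ennreal (g x) = RN_deriv Q P x"
    using absolutely_continuous_AE[OF _ ac] by (simp add: P)
  then have ae: "AE x in P. entropy_density (exp 1) Q P x = ln (g x)"
  proof eventually_elim
    case (elim x)
    show ?case using nonneg[of x] by (simp add: entropy_density_def log_def flip: elim)
  qed
  have [measurable]: "entropy_density (exp 1) Q P \<in> borel_measurable P"
    by (simp add: entropy_density_def comp_def)
  show ?thesis
    using integrable_cong_AE[OF _ _ ae] integral_cong_AE[OF _ _ ae] ac
    by (simp add: KL_def ext_integral_def KL_divergence_def)
qed

text \<open>Gives a version of the Radon-Nikodym derivative that is finite everywhere, so that
  quotients and logarithms can be formed. It vanishes at most on a \<open>P\<close>-null set, and
  off that set the rules for \<open>ln\<close> apply.\<close>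

lemma obtain_real_density:
  assumes "sigma_finite_measure Q" "finite_measure P" "absolutely_continuous Q P" "sets P = sets Q"
  obtains g :: "'a \<Rightarrow> real" where "g \<in> borel_measurable Q" "\<And>x. 0 \<le> g x"
    "P = density Q (\<lambda>x. ennreal (g x))" "AE x in P. 0 < g x"
proof -
  interpret Q: sigma_finite_measure Q by fact
  obtain D where D: "D \<in> borel_measurable Q" "AE x in Q. RN_deriv Q P x = ennreal (D x)"
    "AE x in P. 0 < D x" "\<And>x. 0 \<le> D x"
    using Q.real_RN_deriv[OF assms(2-4)] by blast
  have "P = density Q (RN_deriv Q P)"
    using Q.density_RN_deriv[OF assms(3,4)] by simp
  also have "\<dots> = density Q (\<lambda>x. ennreal (D x))"
    using D by (intro density_cong) auto
  finally show ?thesis using that D by blast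
qed

text \<open>Integration under \<open>P\<close> is integration under \<open>Q\<close> with weight
  \<open>g\<close>, and \<open>g * max 0 (- ln g)\<close> is at most 1 by
  \<open>ln t \<le> t - 1\<close> at \<open>t = 1 / g\<close>. Bounded functions are integrable over
  the finite measure \<open>Q\<close>.\<close>

lemma integrable_neg_ln_density:
  assumes "finite_measure Q" and [measurable]: "g \<in> borel_measurable Q"
    and nonneg: "\<And>x. 0 \<le> g x" and P: "P = density Q (\<lambda>x. ennreal (g x))"
  shows "integrable P (\<lambda>x. max 0 (- ln (g x)))"
proof -
  interpret Q: finite_measure Q by fact
  have bound: "g x * max 0 (- ln (g x)) \<le> 1" for x
  proof (cases "g x = 0")
    case False
    then have "0 < g x" using nonneg[of x] by simp
    moreover from this have "- ln (g x) \<le> 1 / g x - 1"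
      using ln_le_minus_one[of "1 / g x"] by (simp add: ln_div)
    ultimately show ?thesis by (simp add: max_def field_simps)
  qed simp
  have "integrable Q (\<lambda>x. g x *\<^sub>R max 0 (- ln (g x)))"
    by (rule Q.integrable_const_bound[where B=1]) (use bound nonneg in auto)
  then show ?thesis
    unfolding P using nonneg by (subst integrable_density) auto
qed

text \<open>Gibbs' inequality: under \<open>P\<close>, the integral of \<open>- ln g\<close> is at
  most that of \<open>1 / g - 1\<close>, and \<open>1 / g\<close> integrates to the
  \<open>Q\<close>-mass of the set where \<open>g\<close> is positive, hence to at most 1. In the
  remaining cases the value is infinity.\<close>

lemma KL_nonneg:
  assumes "prob_space P" "prob_space Q" "sets P = sets Q"
  shows "0 \<le> KL P Q"
proof (cases "absolutely_continuous Q P")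
  case True
  interpret P: prob_space P by fact
  interpret Q: prob_space Q by fact
  obtain g where [measurable]: "g \<in> borel_measurable Q" and g: "\<And>x. 0 \<le> g x"
    "P = density Q (\<lambda>x. ennreal (g x))" "AE x in P. 0 < g x"
    using obtain_real_density[OF Q.sigma_finite_measure P.finite_measure_axioms True assms(3)] by blast
  have KL: "KL P Q = ext_integral P (\<lambda>x. ln (g x))"
    by (rule KL_density_eq) (use g Q.sigma_finite_measure in auto)
  show ?thesis
  proof (cases "integrable P (\<lambda>x. ln (g x))")
    case int: True
    \<comment> \<open>Since \<open>1 / 0 = 0\<close>, this product is the indicator of the set where
      \<open>g\<close> is positive.\<close>
    have intQ: "integrable Q (\<lambda>x. g x *\<^sub>R (1 / g x))"
      by (rule Q.integrable_const_bound[where B=1]) (auto simp: g(1))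
    have intP: "integrable P (\<lambda>x. 1 / g x)"
      unfolding g(2) using intQ g(1) by (subst integrable_density) auto
    have "(\<integral>x. 1 / g x \<partial>P) = (\<integral>x. g x *\<^sub>R (1 / g x) \<partial>Q)"
      unfolding g(2) using g(1) by (subst integral_density) auto
    also have "\<dots> \<le> (\<integral>x. 1 \<partial>Q)"
      using intQ by (intro integral_mono) auto
    finally have le: "(\<integral>x. 1 / g x \<partial>P) \<le> 1" by (simp add: Q.prob_space)
    have "(\<integral>x. - ln (g x) \<partial>P) \<le> (\<integral>x. 1 / g x - 1 \<partial>P)"
    proof (rule integral_mono_AE)
      show "AE x in P. - ln (g x) \<le> 1 / g x - 1"
        using g(3)
      proof eventually_elim
        case (elim x)
        then show ?case using ln_le_minus_one[of "1 / g x"] by (simp add: ln_div)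
      qed
    qed (use int intP in auto)
    also have "\<dots> \<le> 0" using intP le by (simp add: P.prob_space)
    finally show ?thesis using int by (simp add: KL ext_integral_def)
  qed (simp add: KL ext_integral_def)
qed (simp add: KL_def)

lemma KL_self:
  assumes "sigma_finite_measure M"
  shows "KL M M = 0"
  using KL_density_eq[OF assms, of "\<lambda>_. 1" M] by (simp add: density_1 ext_integral_def)

section \<open>The standard Gaussian as a probability measure\<close>

text \<open>The density factorises over the orthonormal basis into one-dimensional standard normal
  densities, so its integral is a product of integrals each equal to 1.\<close>

lemma prob_space_std_gaussian: "prob_space (std_gaussian :: (real ^ 'd) measure)"
proof
  have density: "exp (- (norm x)\<^sup>2 / 2) / (2 * pi) powr (real CARD('d) / 2)
      = (\<Prod>b\<in>Basis. std_normal_density (x \<bullet> b))" for x :: "real ^ 'd"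
  proof -
    have "(\<Prod>b\<in>Basis. std_normal_density (x \<bullet> b))
        = (1 / sqrt (2 * pi)) ^ CARD('d) * exp (\<Sum>b\<in>Basis. - (x \<bullet> b)\<^sup>2 / 2)"
      by (simp only: std_normal_density_def prod.distrib exp_sum[OF finite_Basis] prod_constant) simp
    also have "(\<Sum>b\<in>Basis. - (x \<bullet> b)\<^sup>2 / 2) = - (norm x)\<^sup>2 / 2"
      unfolding power2_norm_eq_inner
      by (subst euclidean_inner) (simp add: power2_eq_square sum_negf flip: sum_divide_distrib)
    also have "(1 / sqrt (2 * pi)) ^ CARD('d) = 1 / (2 * pi) powr (real CARD('d) / 2)"
      by (simp add: power_one_over powr_powr flip: powr_half_sqrt powr_realpow)
    finally show ?thesis by simp
  qed
  have one: "(\<integral>\<^sup>+x. ennreal (std_normal_density x) \<partial>lborel) = 1"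
    by (simp add: nn_integral_eq_integral)
  have "emeasure (std_gaussian :: (real ^ 'd) measure) (space std_gaussian)
      = (\<integral>\<^sup>+x. (\<Prod>b\<in>Basis. ennreal (std_normal_density (x \<bullet> b))) \<partial>(lborel :: (real ^ 'd) measure))"
    unfolding std_gaussian_def density by (simp add: emeasure_density prod_ennreal)
  also have "\<dots> = 1"
    by (subst nn_integral_lborel_prod) (simp_all add: one)
  finally show "emeasure (std_gaussian :: (real ^ 'd) measure) (space std_gaussian) = 1" .
qed

section \<open>Divergence from a product measure\<close>

lemma absolutely_continuous_trans:
  "absolutely_continuous M N \<Longrightarrow> absolutely_continuous N L \<Longrightarrow> absolutely_continuous M L"
  by (auto simp: absolutely_continuous_def)

text \<open>The preimage of an \<open>A\<close>-null set under \<open>fst\<close> is a cylinder,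
  which is null for the product and therefore for \<open>P\<close>.\<close>

lemma absolutely_continuous_distr_fst:
  assumes "sigma_finite_measure B" "sets P = sets (A \<Otimes>\<^sub>M B)" "absolutely_continuous (A \<Otimes>\<^sub>M B) P"
  shows "absolutely_continuous A (distr P A fst)"
proof -
  interpret B: sigma_finite_measure B by fact
  have [measurable]: "fst \<in> measurable P A"
    using measurable_cong_sets[OF assms(2)] by (metis measurable_fst)
  have sp: "space P = space (A \<Otimes>\<^sub>M B)" by (rule sets_eq_imp_space_eq) fact
  show ?thesis
    unfolding absolutely_continuous_def
  proof
    fix N assume N: "N \<in> null_sets A"
    then have "fst -` N \<inter> space P = N \<times> space B"
      using sets.sets_into_space[of N A] by (auto simp: sp space_pair_measure)
    moreover have "N \<times> space B \<in> null_sets P"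
      using B.times_in_null_sets1[OF N sets.top] assms(3) by (auto simp: absolutely_continuous_def)
    ultimately show "N \<in> null_sets (distr P A fst)"
      using N by (simp add: null_sets_distr_iff null_setsD2)
  qed
qed

lemma absolutely_continuous_distr_snd:
  assumes "sigma_finite_measure B" "sets P = sets (A \<Otimes>\<^sub>M B)" "absolutely_continuous (A \<Otimes>\<^sub>M B) P"
  shows "absolutely_continuous B (distr P B snd)"
proof -
  interpret B: sigma_finite_measure B by fact
  have [measurable]: "snd \<in> measurable P B"
    using measurable_cong_sets[OF assms(2)] by (metis measurable_snd)
  have sp: "space P = space (A \<Otimes>\<^sub>M B)" by (rule sets_eq_imp_space_eq) fact
  show ?thesis
    unfolding absolutely_continuous_def
  proof
    fix N assume N: "N \<in> null_sets B"
    then have "snd -` N \<inter> space P = space A \<times> N"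
      using sets.sets_into_space[of N B] by (auto simp: sp space_pair_measure)
    moreover have "space A \<times> N \<in> null_sets P"
      using B.times_in_null_sets2[OF sets.top N] assms(3) by (auto simp: absolutely_continuous_def)
    ultimately show "N \<in> null_sets (distr P B snd)"
      using N by (simp add: null_sets_distr_iff null_setsD2)
  qed
qed

lemma pair_measure_real_density:
  fixes a :: "'a \<Rightarrow> real" and b :: "'b \<Rightarrow> real"
  assumes [measurable]: "a \<in> borel_measurable A" "b \<in> borel_measurable B"
    and nonneg: "\<And>x. 0 \<le> a x" "\<And>x. 0 \<le> b x"
    and "sigma_finite_measure B" "sigma_finite_measure (density B (\<lambda>x. ennreal (b x)))"
  shows "density A (\<lambda>x. ennreal (a x)) \<Otimes>\<^sub>M density B (\<lambda>x. ennreal (b x))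
    = density (A \<Otimes>\<^sub>M B) (\<lambda>z. ennreal (a (fst z) * b (snd z)))"
  using assms
  by (subst pair_measure_density) (auto simp: split_beta' ennreal_mult intro!: arg_cong[where f="density _"])

text \<open>If \<open>f\<close>, \<open>a\<close>, \<open>b\<close> are the densities of the joint law and of its marginals, then
  \<open>ln f = ln (f / (a b)) + ln a + ln b\<close> almost surely, and each summand is the logarithm of a density
  and so has an integrable negative part. Without absolute continuity both sides are infinite.\<close>
lemma KL_prod_eq_mutual_info:
  assumes A: "prob_space A" and B: "prob_space B" and P: "prob_space P"
    and sets: "sets A = sets S" "sets B = sets T" "sets P = sets (S \<Otimes>\<^sub>M T)"
  shows "KL P (A \<Otimes>\<^sub>M B) = mutual_info S T P + KL (distr P S fst) A + KL (distr P T snd) B"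
proof -
  interpret A: prob_space A by fact
  interpret B: prob_space B by fact
  interpret P: prob_space P by fact
  interpret AB: pair_prob_space A B ..
  let ?P1 = "distr P A fst" and ?P2 = "distr P B snd"
  have P_sets[measurable_cong]: "sets P = sets (A \<Otimes>\<^sub>M B)"
    using sets_pair_measure_cong[OF sets(1,2)] sets(3) by simp
  have [measurable]: "fst \<in> measurable P A" "snd \<in> measurable P B"
    using measurable_cong_sets[OF P_sets] by (metis measurable_fst, metis measurable_snd)
  have marg: "distr P S fst = ?P1" "distr P T snd = ?P2"
    using sets by (auto intro!: distr_cong)
  interpret P1: prob_space ?P1 by (rule P.prob_space_distr) simp
  interpret P2: prob_space ?P2 by (rule P.prob_space_distr) simp
  interpret P12: pair_prob_space ?P1 ?P2 ..
  have "KL P (A \<Otimes>\<^sub>M B) = KL P (?P1 \<Otimes>\<^sub>M ?P2) + (KL ?P1 A + KL ?P2 B)"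
  proof (cases "absolutely_continuous (A \<Otimes>\<^sub>M B) P")
    case True
    note ac = absolutely_continuous_distr_fst[OF B.sigma_finite_measure P_sets True]
      absolutely_continuous_distr_snd[OF B.sigma_finite_measure P_sets True]
    obtain f where f[measurable]: "f \<in> borel_measurable (A \<Otimes>\<^sub>M B)" and f0: "\<And>x. 0 \<le> f x"
      and fP: "P = density (A \<Otimes>\<^sub>M B) (\<lambda>x. ennreal (f x))" and fpos: "AE x in P. 0 < f x"
      using obtain_real_density[OF AB.sigma_finite_measure P.finite_measure_axioms True P_sets] by blast
    obtain a where a[measurable]: "a \<in> borel_measurable A" and a0: "\<And>x. 0 \<le> a x"
      and aP: "?P1 = density A (\<lambda>x. ennreal (a x))" and "AE x in ?P1. 0 < a x"
      using obtain_real_density[OF A.sigma_finite_measure P1.finite_measure_axioms ac(1)] by auto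
    then have apos: "AE x in P. 0 < a (fst x)" by (subst (asm) AE_distr_iff) auto
    obtain b where b[measurable]: "b \<in> borel_measurable B" and b0: "\<And>x. 0 \<le> b x"
      and bP: "?P2 = density B (\<lambda>x. ennreal (b x))" and "AE x in ?P2. 0 < b x"
      using obtain_real_density[OF B.sigma_finite_measure P2.finite_measure_axioms ac(2)] by auto
    then have bpos: "AE x in P. 0 < b (snd x)" by (subst (asm) AE_distr_iff) auto
    \<comment> \<open>The candidate density of \<open>P\<close> relative to the product of its
      marginals: both measures have densities over \<open>A \<Otimes>\<^sub>M B\<close>, and
      \<open>r\<close> is their quotient.\<close>
    define r where "r z = f z / (a (fst z) * b (snd z))" for z
    have r0: "0 \<le> r z" for z by (simp add: r_def f0 a0 b0)
    have r[measurable]: "r \<in> borel_measurable (A \<Otimes>\<^sub>M B)" unfolding r_def[abs_def] by measurable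
    have P12: "?P1 \<Otimes>\<^sub>M ?P2 = density (A \<Otimes>\<^sub>M B) (\<lambda>z. ennreal (a (fst z) * b (snd z)))"
      unfolding aP bP
      by (rule pair_measure_real_density)
        (use a0 b0 B.sigma_finite_measure P2.sigma_finite_measure in \<open>auto simp flip: bP\<close>)
    have "AE z in P. 0 < a (fst z) * b (snd z)"
      using apos bpos by eventually_elim simp
    \<comment> \<open>Passing from \<open>P\<close> to \<open>A \<Otimes>\<^sub>M B\<close> confines
      the property to the set where \<open>f\<close> is positive. Off that set \<open>f\<close> and
      \<open>r\<close> both vanish, so \<open>f = a b r\<close> holds almost everywhere.\<close>
    then have "AE z in A \<Otimes>\<^sub>M B. 0 < f z \<longrightarrow> 0 < a (fst z) * b (snd z)"
      unfolding fP by (subst (asm) AE_density) auto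
    then have "AE z in A \<Otimes>\<^sub>M B.
        ennreal (f z) = ennreal (a (fst z) * b (snd z)) * ennreal (r z)"
    proof eventually_elim
      case (elim z)
      show ?case
      proof (cases "0 < f z")
        case True
        with elim show ?thesis by (auto simp: r_def a0 b0 f0 simp flip: ennreal_mult)
      next
        case False
        with f0[of z] have "f z = 0" by simp
        then show ?thesis by (simp add: r_def)
      qed
    qed
    then have rP: "P = density (?P1 \<Otimes>\<^sub>M ?P2) (\<lambda>z. ennreal (r z))"
      unfolding P12 by (subst density_density_eq) (auto simp: fP intro!: density_cong)
    have P12_sets[measurable_cong]: "sets (?P1 \<Otimes>\<^sub>M ?P2) = sets (A \<Otimes>\<^sub>M B)" by (simp add: P12)
    \<comment> \<open>The product of the marginals is a finite measure with respect to which
      \<open>r\<close> is the density of \<open>P\<close>, so the bound on negative parts applies to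
      \<open>r\<close> as it does to \<open>a\<close> and \<open>b\<close>.\<close>
    have int_r: "integrable P (\<lambda>z. max 0 (- ln (r z)))"
      by (rule integrable_neg_ln_density[OF P12.finite_measure_axioms _ _ rP]) (use r0 in auto)
    have "integrable ?P1 (\<lambda>x. max 0 (- ln (a x)))"
      by (rule integrable_neg_ln_density[OF A.finite_measure_axioms _ _ aP]) (use a0 in auto)
    then have int_a: "integrable P (\<lambda>z. max 0 (- ln (a (fst z))))"
      by (subst (asm) integrable_distr_eq) auto
    have "integrable ?P2 (\<lambda>x. max 0 (- ln (b x)))"
      by (rule integrable_neg_ln_density[OF B.finite_measure_axioms _ _ bP]) (use b0 in auto)
    then have int_b: "integrable P (\<lambda>z. max 0 (- ln (b (snd z))))"
      by (subst (asm) integrable_distr_eq) auto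
    \<comment> \<open>Additivity is used on a nested sum, so the inner sum needs an integrable
      negative part of its own; it is at most the sum of the two negative parts.\<close>
    have int_ab: "integrable P (\<lambda>z. max 0 (- (ln (a (fst z)) + ln (b (snd z)))))"
      by (rule Bochner_Integration.integrable_bound[OF Bochner_Integration.integrable_add[OF int_a int_b]])
        (auto simp: max_def)
    have "KL P (A \<Otimes>\<^sub>M B) = ext_integral P (\<lambda>z. ln (f z))"
      by (rule KL_density_eq[OF AB.sigma_finite_measure _ _ fP]) (use f0 in auto)
    also have "\<dots> = ext_integral P (\<lambda>z. ln (r z) + (ln (a (fst z)) + ln (b (snd z))))"
    proof (rule ext_integral_cong_AE)
      show "AE z in P. ln (f z) = ln (r z) + (ln (a (fst z)) + ln (b (snd z)))"
        using fpos apos bpos by eventually_elim (simp add: r_def ln_div ln_mult)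
    qed auto
    also have "\<dots> = ext_integral P (\<lambda>z. ln (r z))
        + (ext_integral P (\<lambda>z. ln (a (fst z))) + ext_integral P (\<lambda>z. ln (b (snd z))))"
      using int_r int_a int_b int_ab by (simp add: ext_integral_add)
    also have "ext_integral P (\<lambda>z. ln (r z)) = KL P (?P1 \<Otimes>\<^sub>M ?P2)"
      by (rule KL_density_eq[OF P12.sigma_finite_measure _ _ rP, symmetric]) (use r0 in auto)
    also have "ext_integral P (\<lambda>z. ln (a (fst z))) = KL ?P1 A"
      using KL_density_eq[OF A.sigma_finite_measure a a0 aP]
      by (simp add: ext_integral_distr)
    also have "ext_integral P (\<lambda>z. ln (b (snd z))) = KL ?P2 B"
      using KL_density_eq[OF B.sigma_finite_measure b b0 bP]
      by (simp add: ext_integral_distr)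
    finally show ?thesis .
  next
    case False
    have nonneg: "0 \<le> KL P (?P1 \<Otimes>\<^sub>M ?P2)" "0 \<le> KL ?P1 A" "0 \<le> KL ?P2 B"
      by (auto intro!: KL_nonneg P_sets[THEN trans] sets_pair_measure_cong
        P.prob_space_axioms P12.prob_space_axioms A B P1.prob_space_axioms P2.prob_space_axioms)
    \<comment> \<open>All three relations together would give the product of the marginals a density
      over \<open>A \<Otimes>\<^sub>M B\<close>, and transitivity would make \<open>P\<close>
      absolutely continuous after all. So one term on the right is infinite.\<close>
    have "\<not> (absolutely_continuous (?P1 \<Otimes>\<^sub>M ?P2) P
        \<and> absolutely_continuous A ?P1 \<and> absolutely_continuous B ?P2)"
    proof
      assume ac: "absolutely_continuous (?P1 \<Otimes>\<^sub>M ?P2) P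
        \<and> absolutely_continuous A ?P1 \<and> absolutely_continuous B ?P2"
      obtain a where a: "a \<in> borel_measurable A" "\<And>x. 0 \<le> a x" "?P1 = density A (\<lambda>x. ennreal (a x))"
        using obtain_real_density[OF A.sigma_finite_measure P1.finite_measure_axioms] ac by auto
      obtain b where b: "b \<in> borel_measurable B" "\<And>x. 0 \<le> b x" "?P2 = density B (\<lambda>x. ennreal (b x))"
        using obtain_real_density[OF B.sigma_finite_measure P2.finite_measure_axioms] ac by auto
      note [measurable] = a(1) b(1)
      have "?P1 \<Otimes>\<^sub>M ?P2 = density (A \<Otimes>\<^sub>M B) (\<lambda>z. ennreal (a (fst z) * b (snd z)))"
        unfolding a(3) b(3)
        by (rule pair_measure_real_density)
          (use a b B.sigma_finite_measure P2.sigma_finite_measure in \<open>auto simp flip: b(3)\<close>)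
      then have "absolutely_continuous (A \<Otimes>\<^sub>M B) (?P1 \<Otimes>\<^sub>M ?P2)"
        by (auto intro!: absolutely_continuousI_density)
      with ac False show False by (blast intro: absolutely_continuous_trans)
    qed
    then have "KL P (?P1 \<Otimes>\<^sub>M ?P2) = \<infinity> \<or> KL ?P1 A = \<infinity> \<or> KL ?P2 B = \<infinity>"
      by (auto simp: KL_def)
    moreover have "KL P (A \<Otimes>\<^sub>M B) = \<infinity>" using False by (simp add: KL_def)
    ultimately show ?thesis using nonneg by auto
  qed
  then show ?thesis by (simp add: mutual_info_def marg add.assoc)
qed

lemma mutual_info_nonneg:
  assumes "prob_space P" "sets P = sets (S \<Otimes>\<^sub>M T)"
  shows "0 \<le> mutual_info S T P"
proof -
  interpret P: prob_space P by fact
  have [measurable]: "fst \<in> measurable P S" "snd \<in> measurable P T"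
    using measurable_cong_sets[OF assms(2)] by (metis measurable_fst, metis measurable_snd)
  interpret P12: pair_prob_space "distr P S fst" "distr P T snd"
    by (intro pair_prob_space.intro pair_sigma_finite.intro prob_space_imp_sigma_finite P.prob_space_distr) simp_all
  show ?thesis
    unfolding mutual_info_def using assms(2)
    by (intro KL_nonneg P.prob_space_axioms P12.prob_space_axioms)
      (simp cong: sets_pair_measure_cong)
qed

section \<open>Uniform labels and averages over them\<close>

lemma space_label_dist [simp]: "space (label_dist K) = {1..K}"
  by (simp add: label_dist_def space_uniform_count_measure)

lemma sets_label_dist [measurable_cong]: "sets (label_dist K) = sets (count_space {1..K})"
  by (simp add: label_dist_def sets_uniform_count_measure)

lemma prob_space_label_dist: "1 \<le> K \<Longrightarrow> prob_space (label_dist K)"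
  unfolding label_dist_def by (rule prob_space_uniform_count_measure) auto

lemma nn_integral_label_dist:
  "(\<integral>\<^sup>+k. f k \<partial>label_dist K) = (\<Sum>k\<in>{1..K}. ennreal (1 / real K) * f k)"
  by (simp add: label_dist_def uniform_count_measure_def nn_integral_point_measure_finite)

text \<open>The label space is discrete, so every family of probability measures on \<open>N\<close>
  indexed by labels is a kernel.\<close>

lemma measurable_label_dist_subprob:
  assumes "\<And>k. k \<in> {1..K} \<Longrightarrow> prob_space (P k)" "\<And>k. k \<in> {1..K} \<Longrightarrow> sets (P k) = sets N"
  shows "P \<in> measurable (label_dist K) (subprob_algebra N)"
  using assms
  by (subst measurable_cong_sets[OF sets_label_dist refl])
    (auto simp: space_subprob_algebra intro!: prob_space_imp_subprob_space)

lemma label_expectation_nonneg: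
  "(\<And>k. k \<in> {1..K} \<Longrightarrow> 0 \<le> f k) \<Longrightarrow> 0 \<le> label_expectation K f"
  \<comment> \<open>For \<open>K = 0\<close> the sum is empty and \<open>0 / 0\<close> equals 0 in
    \<open>ereal\<close>.\<close>
  by (cases "K = 0") (auto simp: label_expectation_def intro!: sum_nonneg zero_le_divide_ereal)

text \<open>The signs are what the distributive law \<open>ereal_left_distrib\<close> asks for when
  the sum is divided by \<open>K\<close>.\<close>

lemma label_expectation_add:
  assumes "\<And>k. k \<in> {1..K} \<Longrightarrow> 0 \<le> f k" "\<And>k. k \<in> {1..K} \<Longrightarrow> 0 \<le> g k"
  shows "label_expectation K (\<lambda>k. f k + g k) = label_expectation K f + label_expectation K g"
proof -
  have "0 \<le> sum f {1..K}" "0 \<le> sum g {1..K}" using assms by (auto intro!: sum_nonneg)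
  then show ?thesis
    by (simp add: label_expectation_def sum.distrib divide_ereal_def ereal_left_distrib)
qed

lemma label_expectation_cong:
  "(\<And>k. k \<in> {1..K} \<Longrightarrow> f k = g k) \<Longrightarrow> label_expectation K f = label_expectation K g"
  by (simp add: label_expectation_def)

section \<open>The joint law of a variable and its label\<close>

text \<open>The construction of \<open>style_label_law\<close> for an arbitrary family of laws on a
  measurable space \<open>N\<close>. Keeping the label as a coordinate turns an average of
  divergences into a single divergence.\<close>

definition labelled_law :: "nat \<Rightarrow> 'a measure \<Rightarrow> (nat \<Rightarrow> 'a measure) \<Rightarrow> ('a \<times> nat) measure" where
  "labelled_law K N P = label_dist K \<bind> (\<lambda>k. distr (P k) (N \<Otimes>\<^sub>M label_dist K) (\<lambda>s. (s, k)))"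

context
  fixes K :: nat and N :: "'a measure" and P :: "nat \<Rightarrow> 'a measure"
  assumes K: "1 \<le> K"
    and prob: "\<And>k. k \<in> {1..K} \<Longrightarrow> prob_space (P k)"
    and sets: "\<And>k. k \<in> {1..K} \<Longrightarrow> sets (P k) = sets N"
begin

lemma measurable_attach_label:
  "k \<in> {1..K} \<Longrightarrow> (\<lambda>s. (s, k)) \<in> measurable (P k) (N \<Otimes>\<^sub>M label_dist K)"
  by (subst measurable_cong_sets[OF sets refl]) auto

lemma measurable_labelled_kernel:
  "(\<lambda>k. distr (P k) (N \<Otimes>\<^sub>M label_dist K) (\<lambda>s. (s, k)))
    \<in> measurable (label_dist K) (subprob_algebra (N \<Otimes>\<^sub>M label_dist K))"
  by (rule measurable_label_dist_subprob)
    (auto intro!: prob_space.prob_space_distr[OF prob] measurable_attach_label)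

lemma sets_labelled_law: "sets (labelled_law K N P) = sets (N \<Otimes>\<^sub>M label_dist K)"
  unfolding labelled_law_def using K by (intro sets_bind) auto

lemma prob_space_labelled_law: "prob_space (labelled_law K N P)"
proof -
  interpret L: prob_space "label_dist K" using K by (rule prob_space_label_dist)
  show ?thesis
    unfolding labelled_law_def
    by (rule L.prob_space_bind[OF _ measurable_labelled_kernel])
      (auto intro!: prob_space.prob_space_distr[OF prob] measurable_attach_label AE_I2)
qed

lemma nn_integral_labelled_law:
  assumes "h \<in> borel_measurable (N \<Otimes>\<^sub>M label_dist K)"
  shows "(\<integral>\<^sup>+z. h z \<partial>labelled_law K N P)
    = (\<Sum>k\<in>{1..K}. ennreal (1 / real K) * (\<integral>\<^sup>+s. h (s, k) \<partial>P k))"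
  unfolding labelled_law_def using assms
  by (simp add: nn_integral_bind[OF _ measurable_labelled_kernel] nn_integral_label_dist
      nn_integral_distr measurable_attach_label)

text \<open>Every label has positive weight \<open>1 / K\<close>, so \<open>h\<close> is integrable
  under the joint law exactly when all its sections are. In that case the formula for non-negative
  integrals is applied to the positive and negative parts separately.\<close>

lemma ext_integral_labelled_law:
  assumes h: "h \<in> borel_measurable (N \<Otimes>\<^sub>M label_dist K)"
  shows "ext_integral (labelled_law K N P) h
    = label_expectation K (\<lambda>k. ext_integral (P k) (\<lambda>s. h (s, k)))"
proof -
  note [measurable] = h
  have hk: "(\<lambda>s. h (s, k)) \<in> borel_measurable (P k)" if "k \<in> {1..K}" for k
    using measurable_compose[OF measurable_attach_label[OF that] h] .
  have hJ: "h \<in> borel_measurable (labelled_law K N P)"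
    by (subst measurable_cong_sets[OF sets_labelled_law refl]) fact
  have int: "integrable (labelled_law K N P) h
      \<longleftrightarrow> (\<forall>k\<in>{1..K}. integrable (P k) (\<lambda>s. h (s, k)))"
    using hJ hk K
    by (auto simp: integrable_iff_bounded nn_integral_labelled_law ennreal_mult_less_top)
  show ?thesis
  proof (cases "integrable (labelled_law K N P) h")
    case True
    have fin: "(\<integral>\<^sup>+s. ennreal (h (s, k)) \<partial>P k) < \<top>" "(\<integral>\<^sup>+s. ennreal (- h (s, k)) \<partial>P k) < \<top>"
      if "k \<in> {1..K}" for k
      using True int that by (auto simp: real_integrable_def less_top)
    have pos_neg: "(\<lambda>z. ennreal (h z)) \<in> borel_measurable (N \<Otimes>\<^sub>M label_dist K)"
      "(\<lambda>z. ennreal (- h z)) \<in> borel_measurable (N \<Otimes>\<^sub>M label_dist K)"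
      by measurable
    \<comment> \<open>Finiteness of each \<open>F k\<close> is essential, since
      \<open>enn2real\<close> sends infinity to 0 and is additive on finite values only.\<close>
    have average: "enn2real (\<Sum>k\<in>{1..K}. ennreal (1 / real K) * F k) = (\<Sum>k\<in>{1..K}. enn2real (F k)) / real K"
      if "\<And>k. k \<in> {1..K} \<Longrightarrow> F k < \<top>" for F
    proof -
      have "enn2real (\<Sum>k\<in>{1..K}. ennreal (1 / real K) * F k)
          = (\<Sum>k\<in>{1..K}. enn2real (ennreal (1 / real K) * F k))"
        using that by (subst enn2real_sum) (auto simp: ennreal_mult_less_top)
      then show ?thesis by (simp add: enn2real_mult sum_divide_distrib)
    qed
    have "(\<integral>z. h z \<partial>labelled_law K N P) = (\<Sum>k\<in>{1..K}. (\<integral>s. h (s, k) \<partial>P k)) / real K"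
    proof -
      have "(\<integral>z. h z \<partial>labelled_law K N P)
          = (\<Sum>k\<in>{1..K}. enn2real (\<integral>\<^sup>+s. ennreal (h (s, k)) \<partial>P k)) / real K
            - (\<Sum>k\<in>{1..K}. enn2real (\<integral>\<^sup>+s. ennreal (- h (s, k)) \<partial>P k)) / real K"
        using True fin by (simp only: real_lebesgue_integral_def nn_integral_labelled_law pos_neg average)
      also have "\<dots> = (\<Sum>k\<in>{1..K}. (\<integral>s. h (s, k) \<partial>P k)) / real K"
        using True int by (simp add: real_lebesgue_integral_def sum_subtractf diff_divide_distrib)
      finally show ?thesis .
    qed
    then show ?thesis using True int K by (simp add: ext_integral_def label_expectation_def)
  next
    case False
    then obtain k where "k \<in> {1..K}" "\<not> integrable (P k) (\<lambda>s. h (s, k))" using int by blast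
    then have "(\<Sum>k\<in>{1..K}. ext_integral (P k) (\<lambda>s. h (s, k))) = \<infinity>"
      by (subst sum_Pinfty) (auto simp: ext_integral_def)
    then show ?thesis using False K by (simp add: ext_integral_def label_expectation_def)
  qed
qed

text \<open>At \<open>(s, k)\<close> the density of the joint law relative to
  \<open>B \<Otimes>\<^sub>M label_dist K\<close> is the density of \<open>P k\<close> relative to
  \<open>B\<close> at \<open>s\<close>: both measures give each label weight \<open>1 / K\<close>,
  which cancels. Averaging its logarithm over labels yields the right-hand side.\<close>

lemma KL_labelled_law:
  assumes B: "prob_space B" "sets B = sets N"
  shows "KL (labelled_law K N P) (B \<Otimes>\<^sub>M label_dist K) = label_expectation K (\<lambda>k. KL (P k) B)"
proof -
  let ?J = "labelled_law K N P" and ?U = "label_dist K"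
  interpret B: prob_space B by fact
  interpret U: prob_space ?U using K by (rule prob_space_label_dist)
  interpret BU: pair_prob_space B ?U ..
  have BU_sets: "sets (B \<Otimes>\<^sub>M ?U) = sets (N \<Otimes>\<^sub>M ?U)" by (simp add: B(2) cong: sets_pair_measure_cong)
  have U_k: "emeasure ?U {k} = ennreal (1 / real K)" if "k \<in> {1..K}" for k
    using that K by (simp add: label_dist_def emeasure_uniform_count_measure)
  show ?thesis
  proof (cases "\<forall>k\<in>{1..K}. absolutely_continuous B (P k)")
    case True
    have "\<forall>k\<in>{1..K}. \<exists>p::'a \<Rightarrow> real. p \<in> borel_measurable B \<and> (\<forall>x. 0 \<le> p x)
        \<and> P k = density B (\<lambda>x. ennreal (p x))"
    proof
      fix k assume k: "k \<in> {1..K}"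
      interpret Pk: prob_space "P k" using prob[OF k] .
      show "\<exists>p::'a \<Rightarrow> real. p \<in> borel_measurable B \<and> (\<forall>x. 0 \<le> p x)
        \<and> P k = density B (\<lambda>x. ennreal (p x))"
        using obtain_real_density[OF B.sigma_finite_measure Pk.finite_measure_axioms] True k sets B(2)
        by metis
    qed
    then obtain p :: "nat \<Rightarrow> 'a \<Rightarrow> real" where p: "\<And>k. k \<in> {1..K} \<Longrightarrow> p k \<in> borel_measurable B"
      "\<And>k x. k \<in> {1..K} \<Longrightarrow> 0 \<le> p k x"
      "\<And>k. k \<in> {1..K} \<Longrightarrow> P k = density B (\<lambda>x. ennreal (p k x))"
      by metis
    \<comment> \<open>The densities \<open>p k\<close> are controlled for labels in
      \<open>{1..K}\<close> only; the default 0 makes \<open>h\<close> non-negative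
      everywhere.\<close>
    define h where "h z = (if snd z \<in> {1..K} then p (snd z) (fst z) else 0)" for z
    have h0: "0 \<le> h z" for z using p(2) by (simp add: h_def)
    \<comment> \<open>With the countable coordinate first, measurability can be checked section by
      section; the coordinates are then swapped back.\<close>
    have "(\<lambda>(k, x). h (x, k)) \<in> borel_measurable (count_space {1..K} \<Otimes>\<^sub>M B)"
      by (rule measurable_pair_measure_countable1) (use p(1) in \<open>auto simp: h_def\<close>)
    from measurable_pair_swap[OF this] have h[measurable]: "h \<in> borel_measurable (B \<Otimes>\<^sub>M ?U)"
      by (simp cong: measurable_cong_sets sets_pair_measure_cong add: sets_label_dist)
    have J: "?J = density (B \<Otimes>\<^sub>M ?U) (\<lambda>z. ennreal (h z))"
    proof (rule measure_eqI)
      fix X assume X: "X \<in> sets ?J"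
      then have XB[measurable]: "X \<in> sets (B \<Otimes>\<^sub>M ?U)" by (simp add: sets_labelled_law BU_sets)
      have "emeasure ?J X = (\<integral>\<^sup>+z. indicator X z \<partial>?J)" using X by simp
      also have "\<dots> = (\<Sum>k\<in>{1..K}. ennreal (1 / real K) * (\<integral>\<^sup>+s. indicator X (s, k) \<partial>P k))"
        using X by (intro nn_integral_labelled_law) (simp add: sets_labelled_law)
      also have "\<dots> = (\<Sum>k\<in>{1..K}. ennreal (1 / real K) * (\<integral>\<^sup>+s. ennreal (h (s, k)) * indicator X (s, k) \<partial>B))"
      proof (intro sum.cong refl arg_cong2[where f="(*)"])
        fix k assume k: "k \<in> {1..K}"
        then have [measurable]: "p k \<in> borel_measurable B" "k \<in> space ?U" using p(1) by auto
        show "(\<integral>\<^sup>+s. indicator X (s, k) \<partial>P k) = (\<integral>\<^sup>+s. ennreal (h (s, k)) * indicator X (s, k) \<partial>B)"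
          unfolding p(3)[OF k] using k by (subst nn_integral_density) (auto simp: h_def)
      qed
      also have "\<dots> = (\<integral>\<^sup>+k. (\<integral>\<^sup>+s. ennreal (h (s, k)) * indicator X (s, k) \<partial>B) \<partial>?U)"
        by (simp add: nn_integral_label_dist)
      also have "\<dots> = (\<integral>\<^sup>+z. ennreal (h z) * indicator X z \<partial>(B \<Otimes>\<^sub>M ?U))"
        by (rule BU.nn_integral_snd) measurable
      also have "\<dots> = emeasure (density (B \<Otimes>\<^sub>M ?U) (\<lambda>z. ennreal (h z))) X"
        by (simp add: emeasure_density)
      finally show "emeasure ?J X = emeasure (density (B \<Otimes>\<^sub>M ?U) (\<lambda>z. ennreal (h z))) X" .
    qed (simp add: sets_labelled_law BU_sets)
    have "KL ?J (B \<Otimes>\<^sub>M ?U) = ext_integral ?J (\<lambda>z. ln (h z))"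
      by (rule KL_density_eq[OF BU.sigma_finite_measure h h0 J])
    also have "\<dots> = label_expectation K (\<lambda>k. ext_integral (P k) (\<lambda>s. ln (h (s, k))))"
    proof (rule ext_integral_labelled_law)
      have "(\<lambda>z. ln (h z)) \<in> borel_measurable (B \<Otimes>\<^sub>M ?U)" by measurable
      then show "(\<lambda>z. ln (h z)) \<in> borel_measurable (N \<Otimes>\<^sub>M ?U)"
        by (simp cong: measurable_cong_sets add: BU_sets)
    qed
    also have "\<dots> = label_expectation K (\<lambda>k. KL (P k) B)"
    proof (rule label_expectation_cong)
      fix k assume k: "k \<in> {1..K}"
      have "KL (P k) B = ext_integral (P k) (\<lambda>s. ln (p k s))"
        by (rule KL_density_eq[OF B.sigma_finite_measure]) (use p k in auto)
      then show "ext_integral (P k) (\<lambda>s. ln (h (s, k))) = KL (P k) B" using k by (simp add: h_def)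
    qed
    finally show ?thesis .
  next
    case False
    \<comment> \<open>A \<open>B\<close>-null set \<open>X\<close> charged by \<open>P k\<close>
      gives the set \<open>X \<times> {k}\<close>, which is null for the product but has mass
      \<open>1 / K\<close> times that of \<open>X\<close> under the joint law. Both sides are then
      infinite.\<close>
    then obtain k where k: "k \<in> {1..K}" "\<not> absolutely_continuous B (P k)" by auto
    then obtain X where X: "X \<in> null_sets B" "X \<notin> null_sets (P k)"
      by (auto simp: absolutely_continuous_def)
    have XN: "X \<in> sets N" using X B by auto
    have kU: "{k} \<in> sets ?U" using k(1) by (simp add: sets_label_dist)
    have "(\<integral>\<^sup>+z. indicator (X \<times> {k}) z \<partial>?J) = emeasure ?J (X \<times> {k})"
      using XN kU by (intro nn_integral_indicator) (simp add: sets_labelled_law)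
    moreover have "(\<integral>\<^sup>+z. indicator (X \<times> {k}) z \<partial>?J)
        = (\<Sum>j\<in>{1..K}. ennreal (1 / real K) * (\<integral>\<^sup>+s. indicator (X \<times> {k}) (s, j) \<partial>P j))"
      using XN kU by (intro nn_integral_labelled_law borel_measurable_indicator) simp
    moreover have "ennreal (1 / real K) * (\<integral>\<^sup>+s. indicator (X \<times> {k}) (s, k) \<partial>P k)
        = ennreal (1 / real K) * emeasure (P k) X"
      using XN k(1) sets by (simp add: indicator_times)
    moreover have "emeasure (P k) X \<noteq> 0" using X(2) XN sets k(1) by (auto simp: null_sets_def)
    ultimately have "emeasure ?J (X \<times> {k}) \<noteq> 0"
      using k(1) K by auto
    moreover have "X \<times> {k} \<in> null_sets (B \<Otimes>\<^sub>M ?U)"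
      using X kU by (intro U.times_in_null_sets1)
    ultimately have "\<not> absolutely_continuous (B \<Otimes>\<^sub>M ?U) ?J"
      by (auto simp: absolutely_continuous_def)
    moreover have "(\<Sum>k\<in>{1..K}. KL (P k) B) = \<infinity>"
      using k by (subst sum_Pinfty) (auto simp: KL_def)
    ultimately show ?thesis using K by (simp add: KL_def label_expectation_def)
  qed
qed

lemma distr_labelled_law_fst: "distr (labelled_law K N P) N fst = label_dist K \<bind> P"
proof -
  have "distr (labelled_law K N P) N fst
      = label_dist K \<bind> (\<lambda>k. distr (distr (P k) (N \<Otimes>\<^sub>M label_dist K) (\<lambda>s. (s, k))) N fst)"
    unfolding labelled_law_def
    by (rule distr_bind[OF measurable_labelled_kernel]) (use K in auto)
  also have "\<dots> = label_dist K \<bind> P"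
  proof (rule bind_cong_All, safe)
    fix k assume "k \<in> space (label_dist K)"
    then have k: "k \<in> {1..K}" by simp
    have "distr (distr (P k) (N \<Otimes>\<^sub>M label_dist K) (\<lambda>s. (s, k))) N fst = distr (P k) N (\<lambda>s. s)"
      using measurable_attach_label[OF k] by (simp add: distr_distr comp_def)
    also have "\<dots> = P k" using sets[OF k] by (intro distr_id2) simp
    finally show "distr (distr (P k) (N \<Otimes>\<^sub>M label_dist K) (\<lambda>s. (s, k))) N fst = P k" .
  qed
  finally show ?thesis .
qed

lemma distr_labelled_law_snd: "distr (labelled_law K N P) (label_dist K) snd = label_dist K"
proof (rule measure_eqI)
  fix X assume X: "X \<in> sets (distr (labelled_law K N P) (label_dist K) snd)"
  then have XU: "X \<in> sets (label_dist K)" by simp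
  have [measurable]: "snd \<in> measurable (labelled_law K N P) (label_dist K)"
    using measurable_cong_sets[OF sets_labelled_law refl] by (metis measurable_snd)
  have "emeasure (distr (labelled_law K N P) (label_dist K) snd) X
      = (\<integral>\<^sup>+x. indicator X x \<partial>distr (labelled_law K N P) (label_dist K) snd)"
    using XU by simp
  also have "\<dots> = (\<integral>\<^sup>+z. indicator X (snd z) \<partial>labelled_law K N P)"
    using XU by (intro nn_integral_distr) auto
  also have "\<dots> = (\<Sum>k\<in>{1..K}. ennreal (1 / real K) * (\<integral>\<^sup>+s. indicator X k \<partial>P k))"
    using XU by (subst nn_integral_labelled_law) auto
  also have "\<dots> = (\<Sum>k\<in>{1..K}. ennreal (1 / real K) * indicator X k)"
    \<comment> \<open>Each \<open>P k\<close> has total mass 1, so the inner integral of a constant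
      is that constant.\<close>
    using prob_space.emeasure_space_1[OF prob] by (intro sum.cong) auto
  also have "\<dots> = (\<integral>\<^sup>+k. indicator X k \<partial>label_dist K)" by (simp add: nn_integral_label_dist)
  also have "\<dots> = emeasure (label_dist K) X" using XU by simp
  finally show "emeasure (distr (labelled_law K N P) (label_dist K) snd) X = emeasure (label_dist K) X" .
qed simp

text \<open>The compensation identity for a mixture. The first marginal of the joint law is the
  mixture of the \<open>P k\<close>; the second is the uniform law itself, whose divergence from
  itself is 0.\<close>

lemma label_expectation_KL_eq_mutual_info:
  assumes B: "prob_space B" "sets B = sets N"
  shows "label_expectation K (\<lambda>k. KL (P k) B)
    = mutual_info N (label_dist K) (labelled_law K N P) + KL (label_dist K \<bind> P) B"
proof -
  note U = prob_space_label_dist[OF K]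
  show ?thesis
    using KL_prod_eq_mutual_info[OF B(1) U prob_space_labelled_law B(2) refl sets_labelled_law]
    by (simp add: KL_labelled_law[OF B] distr_labelled_law_fst distr_labelled_law_snd
        KL_self[OF prob_space_imp_sigma_finite[OF U]])
qed

end

section \<open>Decomposition of the factorised divergence\<close>

theorem theorem1:
  fixes K :: nat
    and Zc :: "'c measure"
    and q :: "nat \<Rightarrow> ('c \<times> (real ^ 'd)) measure"
    and pc :: "nat \<Rightarrow> 'c measure"
    and ps :: "(real ^ 'd) measure"
  assumes "K \<ge> 1"
    and "\<And>k. k \<in> {1..K} \<Longrightarrow> prob_space (q k)"
    and "\<And>k. k \<in> {1..K} \<Longrightarrow> sets (q k) = sets (Zc \<Otimes>\<^sub>M borel)"
    and "\<And>k. k \<in> {1..K} \<Longrightarrow> prob_space (pc k)"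
    and "\<And>k. k \<in> {1..K} \<Longrightarrow> sets (pc k) = sets Zc"
    and "ps = std_gaussian"
  shows "M_fact K q pc ps =
      cond_mutual_info K Zc q
      + label_expectation K (\<lambda>k. KL (semantic_marginal Zc q k) (pc k))
      + style_label_mutual_info K q
      + KL (aggregated_style K q) ps
    \<and> cond_mutual_info K Zc q \<ge> 0
    \<and> label_expectation K (\<lambda>k. KL (semantic_marginal Zc q k) (pc k)) \<ge> 0
    \<and> style_label_mutual_info K q \<ge> 0
    \<and> KL (aggregated_style K q) ps \<ge> 0"
proof -
  have ps: "prob_space ps" "sets ps = sets borel"
    using prob_space_std_gaussian assms(6) by (simp_all add: std_gaussian_def)
  have fst_q: "fst \<in> measurable (q k) Zc" and snd_q: "snd \<in> measurable (q k) borel"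
    if "k \<in> {1..K}" for k
    using measurable_cong_sets[OF assms(3)[OF that] refl] by (metis measurable_fst, metis measurable_snd)
  have style: "prob_space (style_marginal q k)" "sets (style_marginal q k) = sets borel"
    if "k \<in> {1..K}" for k
    using prob_space.prob_space_distr[OF assms(2)[OF that] snd_q[OF that]]
    by (simp_all add: style_marginal_def)
  have semantic: "prob_space (semantic_marginal Zc q k)" "sets (semantic_marginal Zc q k) = sets Zc"
    if "k \<in> {1..K}" for k
    using prob_space.prob_space_distr[OF assms(2)[OF that] fst_q[OF that]]
    by (simp_all add: semantic_marginal_def)
  have law: "style_label_law K q = labelled_law K borel (style_marginal q)"
    by (simp add: style_label_law_def labelled_law_def)
  have law_prob: "prob_space (style_label_law K q)"
    unfolding law by (rule prob_space_labelled_law[OF assms(1) style]) auto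
  have law_sets: "sets (style_label_law K q) = sets (borel \<Otimes>\<^sub>M label_dist K)"
    unfolding law by (rule sets_labelled_law[OF assms(1) style]) auto
  \<comment> \<open>Needed for the sign of the last term: Gibbs' inequality compares two probability
    measures.\<close>
  have agg: "prob_space (aggregated_style K q)" "sets (aggregated_style K q) = sets borel"
  proof -
    have kernel: "style_marginal q \<in> measurable (label_dist K) (subprob_algebra borel)"
      by (rule measurable_label_dist_subprob) (use style in auto)
    show "prob_space (aggregated_style K q)"
      unfolding aggregated_style_def
      by (rule prob_space.prob_space_bind[OF prob_space_label_dist[OF assms(1)] _ kernel])
        (use style in \<open>auto intro!: AE_I2\<close>)
    show "sets (aggregated_style K q) = sets borel"
      unfolding aggregated_style_def using assms(1) style by (intro sets_bind) auto
  qed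
  have mi: "0 \<le> mutual_info Zc borel (q k)" if "k \<in> {1..K}" for k
    using assms that by (intro mutual_info_nonneg) auto
  have kl_c: "0 \<le> KL (semantic_marginal Zc q k) (pc k)" if "k \<in> {1..K}" for k
    using assms that semantic by (intro KL_nonneg) auto
  have kl_s: "0 \<le> KL (style_marginal q k) ps" if "k \<in> {1..K}" for k
    using that style ps by (intro KL_nonneg) auto
  have "M_fact K q pc ps = label_expectation K (\<lambda>k.
      mutual_info Zc borel (q k) + KL (semantic_marginal Zc q k) (pc k) + KL (style_marginal q k) ps)"
    unfolding M_fact_def
  proof (rule label_expectation_cong)
    fix k assume k: "k \<in> {1..K}"
    show "KL (q k) (pc k \<Otimes>\<^sub>M ps) = mutual_info Zc borel (q k)
        + KL (semantic_marginal Zc q k) (pc k) + KL (style_marginal q k) ps"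
      using KL_prod_eq_mutual_info[OF assms(4)[OF k] ps(1) assms(2)[OF k] assms(5)[OF k] ps(2) assms(3)[OF k]]
      by (simp add: semantic_marginal_def style_marginal_def)
  qed
  \<comment> \<open>The average is additive here because all three families are
    non-negative.\<close>
  also have "\<dots> = cond_mutual_info K Zc q
      + label_expectation K (\<lambda>k. KL (semantic_marginal Zc q k) (pc k))
      + label_expectation K (\<lambda>k. KL (style_marginal q k) ps)"
    unfolding cond_mutual_info_def using mi kl_c kl_s
    by (simp only: label_expectation_add add_nonneg_nonneg)
  \<comment> \<open>The mixture of the style marginals is the aggregated style distribution, so the
    compensation identity with reference \<open>ps\<close> yields the last two terms.\<close>
  also have "label_expectation K (\<lambda>k. KL (style_marginal q k) ps)
      = style_label_mutual_info K q + KL (aggregated_style K q) ps"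
    unfolding style_label_mutual_info_def law aggregated_style_def
    by (rule label_expectation_KL_eq_mutual_info[OF assms(1) style ps]) auto
  finally show ?thesis
    using mi kl_c mutual_info_nonneg[OF law_prob law_sets] KL_nonneg[OF agg(1) ps(1)] agg(2) ps(2)
    by (auto simp: add.assoc cond_mutual_info_def style_label_mutual_info_def intro!: label_expectation_nonneg)
qed

end
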